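(* Let $(\mathcal{B},\mu)$ be a strictly positive atomless normalized measure algebra. (i) If $a,b\in\mathcal{B}$ satisfy $\mu(a)\le\mu(b)$, then $\mu(a\wedge b)=\min\{\mu(a),\mu(b)\}$ if and only if $a\le b$. (ii) Let $T:[0,1]^2\to[0,1]$ satisfy $T(x,y)\in x\star y$ for all $x,y\in[0,1]$. If $T$ is nondecreasing in each argument and idempotent (that is, $T(x,x)=x$ for all $x\in[0,1]$), then $T(x,y)=\min\{x,y\}$ for all $x,y\in[0,1]$.
   Context: A strictly positive atomless normalized measure algebra $(\mathcal{B},\mu)$ is a Dedekind $\sigma$-complete Boolean algebra $\mathcal{B}$ with a countably additive $\mu:\mathcal{B}\to[0,1]$ such that $\mu(1)=1$, $\mu(a)>0$ for every $a\neq 0$, and $\mathcal{B}$ has no atoms. For $x,y\in[0,1]$, the overlap set is $x\star y:=\{\mu(a\wedge b): a,b\in\mathcal{B},\ \mu(a)=x,\ \mu(b)=y\}$. *)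

theory Defs
  imports Complex_Main "HOL-Library.Countable_Complete_Lattices"
begin

text \<open>A Boolean algebra is bounded, so Dedekind \<open>\<sigma>\<close>-completeness (every nonempty countable set
  bounded above has a supremum, every one bounded below an infimum) is the existence of all
  countable suprema and infima, that is, \<^class>\<open>countable_complete_lattice\<close>.\<close>

class sigma_complete_boolean_algebra = boolean_algebra + countable_complete_lattice

definition is_atom :: "'a::boolean_algebra \<Rightarrow> bool" where
  "is_atom a \<longleftrightarrow> a \<noteq> bot \<and> (\<forall>b\<le>a. b = bot \<or> b = a)"

locale atomless_measure_algebra =
  fixes \<mu> :: "'a::sigma_complete_boolean_algebra \<Rightarrow> real"
  assumes range: "\<mu> a \<in> {0..1}"
    and countably_additive:
      "(\<And>i j. i \<noteq> j \<Longrightarrow> inf (A i) (A j) = bot) \<Longrightarrow> (\<lambda>i::nat. \<mu> (A i)) sums \<mu> (SUP i. A i)"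
    and normalized: "\<mu> top = 1"
    and strictly_positive: "a \<noteq> bot \<Longrightarrow> \<mu> a > 0"
    and atomless: "\<not> is_atom a"

definition overlap :: "('a::boolean_algebra \<Rightarrow> real) \<Rightarrow> real \<Rightarrow> real \<Rightarrow> real set" where
  "overlap \<mu> x y = {\<mu> (inf a b) | a b. \<mu> a = x \<and> \<mu> b = y}"

end

theory Submission
  imports Defs
begin

text \<open>Cutting \<open>a\<close> along \<open>b\<close> gives \<mu>(a) = \<mu>(a \<and> b) +
  \<mu>(a \<and> -b) (\<open>measure_split\<close>). Hence \<mu>(a \<and> b) never exceeds \<mu>(a),
  and by symmetry never \<mu>(b), so every overlap value is at most the minimum
  (\<open>overlap_le_min\<close>). Equality with \<mu>(a) forces the remainder a \<and> -b to be
  null, hence zero by strict positivity, which says a \<le> b (\<open>measure_inf_eq_iff\<close>);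
  this is the first claim. For the second, T \<le> min because its values are overlaps, while
  monotonicity and idempotence give T(x,y) \<ge> T(m,m) = m with m = min(x,y).\<close>

context atomless_measure_algebra
begin

text \<open>The constant sequence \<open>bot\<close> is pairwise disjoint, so countable additivity
  makes a constant series converge; its terms must tend to zero.\<close>

lemma measure_bot: "\<mu> bot = 0"
proof -
  have "(\<lambda>i::nat. \<mu> bot) sums \<mu> (SUP i::nat. bot)"
    by (rule countably_additive) simp
  then have "(\<lambda>i::nat. \<mu> bot) \<longlonglongrightarrow> 0"
    by (blast intro: summable_LIMSEQ_zero sums_summable)
  then show ?thesis
    by (simp add: LIMSEQ_const_iff)
qed

lemma measure_sup_disjoint:
  assumes "inf a b = bot"
  shows "\<mu> (sup a b) = \<mu> a + \<mu> b"
proof -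
  \<comment> \<open>Padding the pair with \<open>bot\<close> turns it into a disjoint sequence; by
    \<open>measure_bot\<close> the padding adds nothing to the series.\<close>
  define A where "A i = (if i = 0 then a else if i = 1 then b else bot)" for i :: nat
  have "(\<lambda>i. \<mu> (A i)) sums \<mu> (SUP i. A i)"
    by (rule countably_additive) (use assms in \<open>auto simp: A_def inf.commute\<close>)
  moreover have "(SUP i. A i) = sup a b"
  proof (rule antisym)
    show "(SUP i. A i) \<le> sup a b"
      by (rule ccSUP_least) (auto simp: A_def)
    show "sup a b \<le> (SUP i. A i)"
      using ccSUP_upper[of UNIV 0 A] ccSUP_upper[of UNIV 1 A] by (simp add: A_def)
  qed
  moreover have "(\<lambda>i. \<mu> (A i)) sums (\<Sum>i\<in>{0, 1}. \<mu> (A i))"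
    by (rule sums_finite) (auto simp: A_def measure_bot)
  ultimately show ?thesis
    using sums_unique2 by (fastforce simp: A_def)
qed

lemma measure_split: "\<mu> a = \<mu> (inf a b) + \<mu> (inf a (- b))"
proof -
  have "inf (inf a b) (inf a (- b)) = inf a (inf b (- b))"
    by (simp only: inf_assoc inf_left_commute inf_left_idem)
  then have "inf (inf a b) (inf a (- b)) = bot"
    by simp
  moreover have "sup (inf a b) (inf a (- b)) = a"
    by (simp flip: inf_sup_distrib1)
  ultimately show ?thesis
    using measure_sup_disjoint by metis
qed

lemma measure_inf_le: "\<mu> (inf a b) \<le> \<mu> a"
  using measure_split[of a b] range[of "inf a (- b)"] by simp

text \<open>Strict positivity enters here: it upgrades "a \<le> b up to a null element" to a genuine
  inequality in the algebra.\<close>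

lemma measure_inf_eq_iff: "\<mu> (inf a b) = \<mu> a \<longleftrightarrow> a \<le> b"
proof
  assume "\<mu> (inf a b) = \<mu> a"
  then have "\<mu> (inf a (- b)) = 0"
    using measure_split[of a b] by simp
  then have "inf a (- b) = bot"
    using strictly_positive[of "inf a (- b)"] by fastforce
  then show "a \<le> b"
    by (simp add: inf_shunt)
qed (simp add: inf_absorb1)

lemma overlap_le_min:
  assumes "z \<in> overlap \<mu> x y"
  shows "z \<le> min x y"
proof -
  obtain a b where "z = \<mu> (inf a b)" "\<mu> a = x" "\<mu> b = y"
    using assms unfolding overlap_def by blast
  then show ?thesis
    using measure_inf_le[of a b] measure_inf_le[of b a] by (simp add: inf.commute)
qed

end

theorem theorem2:
  fixes \<mu> :: "'a::sigma_complete_boolean_algebra \<Rightarrow> real"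
  assumes "atomless_measure_algebra \<mu>"
  shows "(\<forall>a b. \<mu> a \<le> \<mu> b \<longrightarrow> (\<mu> (inf a b) = min (\<mu> a) (\<mu> b) \<longleftrightarrow> a \<le> b)) \<and>
    (\<forall>T :: real \<Rightarrow> real \<Rightarrow> real.
      (\<forall>x\<in>{0..1}. \<forall>y\<in>{0..1}. T x y \<in> {0..1}) \<longrightarrow>
      (\<forall>x\<in>{0..1}. \<forall>y\<in>{0..1}. T x y \<in> overlap \<mu> x y) \<longrightarrow>
      (\<forall>y\<in>{0..1}. mono_on {0..1} (\<lambda>x. T x y)) \<longrightarrow>
      (\<forall>x\<in>{0..1}. mono_on {0..1} (\<lambda>y. T x y)) \<longrightarrow>
      (\<forall>x\<in>{0..1}. T x x = x) \<longrightarrow>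
      (\<forall>x\<in>{0..1}. \<forall>y\<in>{0..1}. T x y = min x y))"
proof -
  interpret atomless_measure_algebra \<mu>
    by fact
  show ?thesis
  proof (intro conjI allI impI ballI)
    fix a b :: 'a
    assume "\<mu> a \<le> \<mu> b"
    then show "\<mu> (inf a b) = min (\<mu> a) (\<mu> b) \<longleftrightarrow> a \<le> b"
      \<comment> \<open>The assumption makes the minimum equal to \<open>\<mu> a\<close>.\<close>
      by (simp add: measure_inf_eq_iff)
  next
    fix T :: "real \<Rightarrow> real \<Rightarrow> real" and x y :: real
    assume T: "\<forall>x\<in>{0..1}. \<forall>y\<in>{0..1}. T x y \<in> overlap \<mu> x y"
      and mono1: "\<forall>y\<in>{0..1}. mono_on {0..1} (\<lambda>x. T x y)"
      and mono2: "\<forall>x\<in>{0..1}. mono_on {0..1} (\<lambda>y. T x y)"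
      and idem: "\<forall>x\<in>{0..1}. T x x = x"
      and x: "x \<in> {0..1}" and y: "y \<in> {0..1}"
    \<comment> \<open>Lowering the larger argument to the smaller one reaches the diagonal, where
      idempotence gives the value. Which argument is lowered decides which monotonicity is
      used.\<close>
    have "min x y \<le> T x y"
    proof (cases "x \<le> y")
      case True
      then have "T x x \<le> T x y"
        using mono_onD[OF mono2[rule_format, OF x] x y] by simp
      then show ?thesis
        using True idem x by simp
    next
      case False
      then have "T y y \<le> T x y"
        using mono_onD[OF mono1[rule_format, OF y] y x] by simp
      then show ?thesis
        using False idem y by simp
    qed
    then show "T x y = min x y"
      using overlap_le_min T x y by (blast intro: antisym)
  qed
qed

end
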